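(* For a nonnegative integer $s$, let $MP_n(s)$ denote the number of $n\times n$ pandiagonal magic squares of magic sum $s$. Then, for every integer $s\ge 0$, $$MP_4(s) = \begin{cases} \frac{1}{48}(s^2 + 4s + 12)(s+2)^2 & \text{if } 2\mid s, \\ 0 & \text{otherwise,} \end{cases}$$ and $$MP_5(s) = \frac{1}{8064}(s+4)(s+3)(s+2)(s+1)(s^2 + 5s + 8)(s^2 + 5s + 42).$$
   Context: An $n\times n$ magic square is an $n\times n$ matrix with nonnegative integer entries (repetitions allowed) whose row sums, column sums, and two main diagonal sums are all equal to the same integer $s$, called the magic sum. A pandiagonal magic square is a magic square with the additional property that every broken-line diagonal sum also equals $s$; that is, with indices taken modulo $n$, $\sum_{i} x_{i,\,i+j}=s$ and $\sum_i x_{i,\,j-i}=s$ for every $j$ (so all $n$ wrap-around diagonals in each of the two directions have sum $s$). *)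

theory Defs
  imports Complex_Main "Jordan_Normal_Form.Matrix"
begin

text \<open>Rows and columns are indexed by \<open>0, \<dots>, n - 1\<close>.\<close>

definition magic_square :: "nat \<Rightarrow> nat \<Rightarrow> nat mat \<Rightarrow> bool" where
  "magic_square n s A \<longleftrightarrow>
     A \<in> carrier_mat n n \<and>
     (\<forall>i<n. (\<Sum>j<n. A $$ (i, j)) = s) \<and>
     (\<forall>j<n. (\<Sum>i<n. A $$ (i, j)) = s) \<and>
     (\<Sum>i<n. A $$ (i, i)) = s \<and>
     (\<Sum>i<n. A $$ (i, n - 1 - i)) = s"

text \<open>For \<open>i < n\<close>, the natural number \<open>(j + (n - i)) mod n\<close> is the residue of \<open>j - i\<close> modulo \<open>n\<close>;
  the summand \<open>n\<close> avoids truncated subtraction.\<close>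

definition pandiagonal_magic_square :: "nat \<Rightarrow> nat \<Rightarrow> nat mat \<Rightarrow> bool" where
  "pandiagonal_magic_square n s A \<longleftrightarrow>
     magic_square n s A \<and>
     (\<forall>j<n. (\<Sum>i<n. A $$ (i, (i + j) mod n)) = s) \<and>
     (\<forall>j<n. (\<Sum>i<n. A $$ (i, (j + (n - i)) mod n)) = s)"

text \<open>The set counted here is finite, since the row sums bound all entries by \<open>s\<close>.\<close>

definition MP :: "nat \<Rightarrow> nat \<Rightarrow> nat" where
  "MP n s = card {A. pandiagonal_magic_square n s A}"

end

theory Submission
  imports Defs
begin

text \<open>
  \<^emph>\<open>Order five.\<close> Four of the six parallel classes of lines of the plane over the field with five
  elements have constant sums, which forces \<open>x(i, j) = f(j - 2 i) + g(j + 2 i)\<close>, the level sets of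
  the two arguments being the lines of the other two classes. Normalising \<open>min f = 0\<close> makes \<open>f\<close> and
  \<open>g\<close> unique and nonnegative, and the magic sum is the sum of all ten values. Hence the squares
  correspond to the weak compositions of \<open>s\<close> into ten parts except those whose first five parts are
  all positive, and their number is \<open>(s + 9 choose 9) - (s + 4 choose 9)\<close>.

  \<^emph>\<open>Order four.\<close> Entries at distance \<open>(2, 2)\<close> add up to \<open>t = s / 2\<close>. Identify the cells with the
  vertices of the 4-cube and replace \<open>x\<close> by \<open>t - x\<close> on one colour class of the checkerboard: the
  squares become the affine functions on the cube with antipodal sum \<open>t\<close> and integer values in
  \<open>{0..t}\<close>. With slopes \<open>d\<close> the minimum is \<open>(t - \<bar>d\<bar>) / 2\<close> in the 1-norm, so they
  correspond to the integer points \<open>d\<close> with \<open>\<bar>d\<bar> \<le> t\<close> and \<open>\<bar>d\<bar> \<equiv> t (mod 2)\<close>.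
\<close>

lemma all_less_4: "(\<forall>i<4::nat. P i) \<longleftrightarrow> P 0 \<and> P 1 \<and> P 2 \<and> P 3"
  by (simp add: numeral_eq_Suc All_less_Suc conj_ac)

lemma all_less_5: "(\<forall>i<5::nat. P i) \<longleftrightarrow> P 0 \<and> P 1 \<and> P 2 \<and> P 3 \<and> P 4"
  by (simp add: numeral_eq_Suc All_less_Suc conj_ac)

lemma sum_lessThan_4: "sum f {..<4::nat} = f 0 + f 1 + f 2 + f 3"
  by (simp add: numeral_eq_Suc)

lemma sum_lessThan_5: "sum f {..<5::nat} = f 0 + f 1 + f 2 + f 3 + f 4"
  by (simp add: numeral_eq_Suc)

subsection \<open>Order five\<close>

text \<open>The first five entries of the list are \<open>f\<close>, the last five are \<open>g\<close>.\<close>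

definition square_of_list :: "nat list \<Rightarrow> nat mat" where
  "square_of_list l =
     mat 5 5 (\<lambda>(i, j). l ! ((j + 3 * i) mod 5) + l ! (5 + (j + 2 * i) mod 5))"

text \<open>The cell \<open>(u + 4 v, 3 u + 3 v)\<close> solves \<open>u = j - 2 i\<close> and \<open>v = j + 2 i\<close> modulo 5.\<close>

lemma square_of_list_coordinates:
  assumes "u < 5" "v < 5"
  shows "square_of_list l $$ ((u + 4 * v) mod 5, (3 * u + 3 * v) mod 5) = l ! u + l ! (5 + v)"
proof -
  have "\<forall>u<5. \<forall>v<5. ((3 * u + 3 * v) mod 5 + 3 * ((u + 4 * v) mod 5)) mod 5 = u
      \<and> ((3 * u + 3 * v) mod 5 + 2 * ((u + 4 * v) mod 5)) mod 5 = (v::nat)"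
    unfolding all_less_5 by simp
  with assms show ?thesis
    by (simp add: square_of_list_def)
qed

lemma pandiagonal_square_of_list:
  assumes "length l = 10"
  shows "pandiagonal_magic_square 5 (sum_list l) (square_of_list l)"
proof -
  have "sum_list l = l!0 + l!1 + l!2 + l!3 + l!4 + l!5 + l!6 + l!7 + l!8 + l!9"
    using assms by (simp add: sum_list_sum_nth numeral_eq_Suc numeral_2_eq_2)
  then show ?thesis
    unfolding pandiagonal_magic_square_def magic_square_def all_less_5 sum_lessThan_5
    by (simp add: square_of_list_def numeral_2_eq_2[symmetric])
qed

text \<open>The six lines through a point cover every other point once and the point itself six times.\<close>

lemma six_lines:
  fixes A :: "nat mat"
  assumes "u < 5" "v < 5"
  defines "y \<equiv> \<lambda>u v. A $$ ((u + 4 * v) mod 5, (3 * u + 3 * v) mod 5)"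
  shows "(\<Sum>j<5. A $$ ((u + 4 * v) mod 5, j)) + (\<Sum>i<5. A $$ (i, (3 * u + 3 * v) mod 5))
       + (\<Sum>i<5. A $$ (i, (i + (2 * u + 4 * v) mod 5) mod 5))
       + (\<Sum>i<5. A $$ (i, ((4 * u + 2 * v) mod 5 + (5 - i)) mod 5))
       + (\<Sum>b<5. y u b) + (\<Sum>a<5. y a v)
     = 5 * y u v + (\<Sum>i<5. \<Sum>j<5. A $$ (i, j))"
proof -
  have "u \<in> {0, 1, 2, 3, 4}" "v \<in> {0, 1, 2, 3, 4}"
    using assms(1,2) by auto
  then show ?thesis
    unfolding y_def sum_lessThan_5
    by (elim insertE emptyE; hypsubst; simp flip: numeral_2_eq_2)
qed

text \<open>Four of the six lines sum to \<open>s\<close> and all cells to \<open>5 * s\<close>, so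
  \<open>5 * y u v\<close> is a function of \<open>u\<close> plus a function of
  \<open>v\<close>.\<close>

lemma pandiagonal_5_additive:
  assumes "pandiagonal_magic_square 5 s A" "u < 5" "v < 5"
  defines "y \<equiv> \<lambda>u v. A $$ ((u + 4 * v) mod 5, (3 * u + 3 * v) mod 5)"
  shows "y u v + y 0 0 = y u 0 + y 0 v"
proof -
  have "4 * s + (\<Sum>b<5. y a b) + (\<Sum>b<5. y b c) = 5 * y a c + 5 * s"
    if "a < 5" "c < 5" for a c
    using six_lines[OF that, of A] assms(1)
    by (simp add: pandiagonal_magic_square_def magic_square_def y_def)
  from this[OF assms(2,3)] this[of 0 0] this[of u 0] this[of 0 v] assms(2,3)
  show ?thesis by simp
qed

lemma square_of_list_inj:
  "inj_on square_of_list {l. length l = 10 \<and> (\<exists>u<5. l ! u = 0)}"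
proof (rule inj_onI)
  fix l m
  assume l: "l \<in> {l. length l = 10 \<and> (\<exists>u<5. l ! u = 0)}"
    and m: "m \<in> {l. length l = 10 \<and> (\<exists>u<5. l ! u = 0)}"
    and eq: "square_of_list l = square_of_list m"
  have sums: "l ! u + l ! (5 + v) = m ! u + m ! (5 + v)" if "u < 5" "v < 5" for u v
    using square_of_list_coordinates[OF that] eq by metis
  obtain a b where ab: "a < 5" "l ! a = 0" "b < 5" "m ! b = 0"
    using l m by auto
  \<comment> \<open>Row \<open>a\<close>, where \<open>l\<close> vanishes, gives one inequality
    between the two values; row \<open>b\<close> gives the other.\<close>
  have right: "l ! (5 + v) = m ! (5 + v)" if "v < 5" for v
    using sums[OF \<open>a < 5\<close> that] sums[OF \<open>b < 5\<close> that] ab by linarith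
  have left: "l ! u = m ! u" if "u < 5" for u
    using sums[OF that, of 0] right[of 0] by simp
  show "l = m"
  proof (rule nth_equalityI)
    show "length l = length m"
      using l m by simp
    fix i assume "i < length l"
    then have "i < 5 \<or> i - 5 < 5 \<and> i = 5 + (i - 5)"
      using l by auto
    then show "l ! i = m ! i"
      using left right by metis
  qed
qed

lemma square_of_list_surj:
  assumes "pandiagonal_magic_square 5 s A"
  obtains l where "length l = 10" "sum_list l = s" "\<exists>u<5. l ! u = 0" "A = square_of_list l"
proof -
  define y where "y u v = A $$ ((u + 4 * v) mod 5, (3 * u + 3 * v) mod 5)" for u v
  have additive: "y u v + y 0 0 = y u 0 + y 0 v" if "u < 5" "v < 5" for u v
    using pandiagonal_5_additive[OF assms that] by (simp add: y_def)
  obtain a where a: "a < 5" "\<And>u. u < 5 \<Longrightarrow> y a 0 \<le> y u 0"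
    using ex_min_if_finite[of "(\<lambda>u. y u 0) ` {..<5}"] by (fastforce simp: not_less)
  \<comment> \<open>Minimality of \<open>a\<close> makes the subtraction exact; the second half is
    nonnegative because it consists of entries of \<open>A\<close>.\<close>
  define l where "l = map (\<lambda>u. y u 0 - y a 0) [0..<5] @ map (y a) [0..<5]"
  have len: "length l = 10"
    by (simp add: l_def)
  have left: "l ! u = y u 0 - y a 0" and right: "l ! (5 + u) = y a u" if "u < 5" for u
    using that by (simp_all add: l_def nth_append)
  have entry: "l ! u + l ! (5 + v) = y u v" if "u < 5" "v < 5" for u v
    using left[OF that(1)] right[OF that(2)] a(2)[OF that(1)] additive[OF that]
      additive[OF a(1) that(2)] by linarith
  have A: "A = square_of_list l"
  proof (rule eq_matI)
    fix i j assume "i < dim_row (square_of_list l)" "j < dim_col (square_of_list l)"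
    then have ij: "i < 5" "j < 5"
      by (simp_all add: square_of_list_def)
    have "\<forall>i<5. \<forall>j<5. ((j + 3 * i) mod 5 + 4 * ((j + 2 * i) mod 5)) mod 5 = i
        \<and> (3 * ((j + 3 * i) mod 5) + 3 * ((j + 2 * i) mod 5)) mod 5 = (j::nat)"
      unfolding all_less_5 by simp
    with ij have "y ((j + 3 * i) mod 5) ((j + 2 * i) mod 5) = A $$ (i, j)"
      by (simp add: y_def)
    then show "A $$ (i, j) = square_of_list l $$ (i, j)"
      using entry[of "(j + 3 * i) mod 5" "(j + 2 * i) mod 5"] ij by (simp add: square_of_list_def)
  qed (use assms in \<open>auto simp: square_of_list_def pandiagonal_magic_square_def magic_square_def\<close>)
  have "(\<Sum>j<5. A $$ (0, j)) = s"
    using assms by (simp add: pandiagonal_magic_square_def magic_square_def)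
  moreover have "(\<Sum>j<5. A $$ (0, j)) = sum_list l"
    using pandiagonal_square_of_list[OF len]
    by (simp add: A pandiagonal_magic_square_def magic_square_def)
  moreover have "\<exists>u<5. l ! u = 0"
    using left[OF a(1)] a(1) by auto
  ultimately show ?thesis
    using that len A by simp
qed

lemma MP_5_eq_card_lists:
  "MP 5 s = card {l. length l = 10 \<and> sum_list l = s \<and> (\<exists>u<5. l ! u = 0)}"
    (is "_ = card ?L")
proof -
  have inj: "inj_on square_of_list ?L"
    using square_of_list_inj by (rule inj_on_subset) auto
  have image: "square_of_list ` ?L = {A. pandiagonal_magic_square 5 s A}"
    by (auto intro: pandiagonal_square_of_list elim!: square_of_list_surj)
  show ?thesis
    using card_image[OF inj] unfolding MP_def image .
qed

section \<open>Counting the compositions\<close>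

lemma card_length_10_sum_list:
  "card {l::nat list. length l = 10 \<and> sum_list l = N} = (N + 9) choose 9"
  unfolding card_length_sum_list using binomial_symmetric[of 9 "N + 9"]
  by (simp add: add.commute[of N])

text \<open>Lowering the first five parts by one leaves a weak composition of \<open>s - 5\<close>.
  For \<open>s < 5\<close> both sides are 0.\<close>

lemma card_lists_left_positive:
  "card {l::nat list. length l = 10 \<and> sum_list l = s \<and> (\<forall>u<5. l ! u \<noteq> 0)} = (s + 4) choose 9"
    (is "card ?P = _")
proof (cases "5 \<le> s")
  case True
  let ?up = "\<lambda>l. map Suc (take 5 l) @ drop 5 l" and ?down = "\<lambda>l. map (\<lambda>x. x - 1) (take 5 l) @ drop 5 l"
  have "bij_betw ?up {l. length l = 10 \<and> sum_list l = s - 5} ?P"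
  proof (rule bij_betw_byWitness[where f' = ?down])
    have up: "sum_list (?up l) = sum_list l + 5" if "length l = 10" for l :: "nat list"
    proof -
      have "sum_list (map Suc xs) = sum_list xs + length xs" for xs
        by (induction xs) auto
      moreover have "sum_list l = sum_list (take 5 l) + sum_list (drop 5 l)"
        by (metis append_take_drop_id sum_list_append)
      ultimately show ?thesis
        using that by simp
    qed
    have down: "?up (?down l) = l" if "length l = 10" "\<forall>u<5. l ! u \<noteq> 0" for l :: "nat list"
      using that by (intro nth_equalityI) (auto simp: nth_append)
    show "\<forall>l\<in>{l. length l = 10 \<and> sum_list l = s - 5}. ?down (?up l) = l"
      by (auto intro!: nth_equalityI simp: nth_append)
    show "\<forall>l\<in>?P. ?up (?down l) = l"
      using down by blast
    show "?up ` {l. length l = 10 \<and> sum_list l = s - 5} \<subseteq> ?P"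
      using up True by (auto simp: nth_append simp del: sum_list_append)
    show "?down ` ?P \<subseteq> {l. length l = 10 \<and> sum_list l = s - 5}"
    proof
      fix k assume "k \<in> ?down ` ?P"
      then obtain l where l: "l \<in> ?P" "k = ?down l"
        by blast
      have "length k = 10"
        using l by simp
      moreover have "?up k = l"
        unfolding l(2) using l(1) by (intro down) auto
      then have "sum_list k + 5 = s"
        using up[OF \<open>length k = 10\<close>] l(1) by simp
      ultimately show "k \<in> {l. length l = 10 \<and> sum_list l = s - 5}"
        by auto
    qed
  qed
  then have "card ?P = card {l::nat list. length l = 10 \<and> sum_list l = s - 5}"
    by (simp add: bij_betw_same_card)
  with True show ?thesis
    by (simp add: card_length_10_sum_list add.commute)
next
  case False
  have "s \<ge> 5" if l: "l \<in> ?P" for l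
  proof -
    have "l ! 0 + l ! 1 + l ! 2 + l ! 3 + l ! 4 \<le> sum_list l"
      using l by (simp add: sum_list_sum_nth numeral_eq_Suc numeral_2_eq_2)
    moreover have "0 < l ! 0" "0 < l ! 1" "0 < l ! 2" "0 < l ! 3" "0 < l ! 4"
      using l by simp_all
    ultimately have "5 \<le> sum_list l"
      by linarith
    then show ?thesis
      using l by simp
  qed
  with False have "?P = {}"
    by blast
  then show ?thesis
    unfolding \<open>?P = {}\<close> using False by simp
qed

lemma MP_5_eq_binomial: "MP 5 s + ((s + 4) choose 9) = (s + 9) choose 9"
proof -
  let ?L = "{l::nat list. length l = 10 \<and> sum_list l = s}"
  have card_L: "card ?L = (s + 9) choose 9"
    by (rule card_length_10_sum_list)
  then have "finite ?L"
    by (intro card_ge_0_finite) simp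
  let ?Z = "{l. length l = 10 \<and> sum_list l = s \<and> (\<exists>u<5. l ! u = 0)}"
    and ?P = "{l::nat list. length l = 10 \<and> sum_list l = s \<and> (\<forall>u<5. l ! u \<noteq> 0)}"
  have "?L = ?Z \<union> ?P"
    by auto
  moreover have "card (?Z \<union> ?P) = card ?Z + card ?P"
    by (rule card_Un_disjoint) (auto intro: finite_subset[OF _ \<open>finite ?L\<close>])
  ultimately have "card ?L = card ?Z + card ?P"
    by simp
  then show ?thesis
    unfolding card_L MP_5_eq_card_lists card_lists_left_positive by simp
qed

text \<open>The denominator is 9!. For \<open>n < 9\<close> a factor vanishes, so small
  \<open>s\<close> needs no separate case.\<close>

lemma real_binomial_9:
  "real (n choose 9) = (\<Prod>i<9. real n - real i) / 362880"
  by (simp add: binomial_gbinomial gbinomial_prod_rev atLeast0LessThan fact_numeral)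

lemma MP_5:
  "real (MP 5 s) = 1 / 8064 * (real s + 4) * (real s + 3) * (real s + 2) * (real s + 1) *
     ((real s)^2 + 5 * real s + 8) * ((real s)^2 + 5 * real s + 42)"
proof -
  have "real (MP 5 s) = real ((s + 9) choose 9) - real ((s + 4) choose 9)"
    using MP_5_eq_binomial[of s] by linarith
  then show ?thesis
    unfolding real_binomial_9 by (simp add: numeral_eq_Suc) (simp add: field_simps power2_eq_square)
qed

subsection \<open>Order four\<close>

text \<open>Lattice points of the \<open>t\<close>-fold dilated cross polytope whose coordinate sum has the parity
  of \<open>t\<close>.\<close>

definition cross :: "nat \<Rightarrow> nat \<Rightarrow> int list set" where
  "cross n t = {d. length d = n \<and> (\<exists>k. sum_list (map (\<lambda>x. nat \<bar>x\<bar>) d) + 2 * k = t)}"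

lemma cross_0: "cross 0 t = (if even t then {[]} else {})"
  by (auto simp: cross_def elim: evenE)

text \<open>The first coordinate \<open>x\<close> uses up |x| of \<open>t\<close>, and the slack
  \<open>2 * k\<close> passes unchanged to the tail. The range of \<open>x\<close> keeps
  \<open>t - nat |x|\<close> exact.\<close>

lemma cross_Suc:
  "cross (Suc n) t = (\<Union>x\<in>{- int t..int t}. (#) x ` cross n (t - nat \<bar>x\<bar>))"
proof (intro equalityI subsetI)
  fix d assume "d \<in> cross (Suc n) t"
  then obtain x e k where *: "d = x # e" "length e = n"
      "nat \<bar>x\<bar> + sum_list (map (\<lambda>x. nat \<bar>x\<bar>) e) + 2 * k = t"
    by (auto simp: cross_def length_Suc_conv)
  then have "e \<in> cross n (t - nat \<bar>x\<bar>)" and "x \<in> {- int t..int t}"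
    by (auto simp: cross_def)
  with * show "d \<in> (\<Union>x\<in>{- int t..int t}. (#) x ` cross n (t - nat \<bar>x\<bar>))"
    by blast
next
  fix d assume "d \<in> (\<Union>x\<in>{- int t..int t}. (#) x ` cross n (t - nat \<bar>x\<bar>))"
  then obtain x e k where *: "d = x # e" "length e = n" "nat \<bar>x\<bar> \<le> t"
      "sum_list (map (\<lambda>x. nat \<bar>x\<bar>) e) + 2 * k = t - nat \<bar>x\<bar>"
    by (auto simp: cross_def)
  then have "sum_list (map (\<lambda>x. nat \<bar>x\<bar>) d) + 2 * k = t"
    by simp
  with * show "d \<in> cross (Suc n) t"
    by (auto simp: cross_def)
qed

lemma finite_cross: "finite (cross n t)"
  by (induction n arbitrary: t) (simp_all add: cross_0 cross_Suc)

lemma sum_symmetric_interval: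
  fixes f :: "nat \<Rightarrow> nat"
  shows "(\<Sum>x\<in>{- int t..int t}. f (t - nat \<bar>x\<bar>)) = f t + 2 * (\<Sum>k<t. f k)"
proof -
  have "{- int t..int t} = {- int t..-1} \<union> {0} \<union> {1..int t}"
    by auto
  then have "(\<Sum>x\<in>{- int t..int t}. f (t - nat \<bar>x\<bar>)) =
      (\<Sum>x\<in>{- int t..-1}. f (t - nat \<bar>x\<bar>)) + f t + (\<Sum>x\<in>{1..int t}. f (t - nat \<bar>x\<bar>))"
    by (simp add: sum.union_disjoint)
  also have "(\<Sum>x\<in>{- int t..-1}. f (t - nat \<bar>x\<bar>)) = (\<Sum>k<t. f k)"
    by (rule sum.reindex_bij_witness[of _ "\<lambda>k. int k - int t" "\<lambda>x. nat (int t + x)"]) 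
      (auto simp: nat_diff_distrib' intro!: arg_cong[of _ _ f])
  also have "(\<Sum>x\<in>{1..int t}. f (t - nat \<bar>x\<bar>)) = (\<Sum>k<t. f k)"
    by (rule sum.reindex_bij_witness[of _ "\<lambda>k. int t - int k" "\<lambda>x. nat (int t - x)"])
      (auto simp: nat_diff_distrib' intro!: arg_cong[of _ _ f])
  finally show ?thesis
    by simp
qed

lemma card_cross_Suc:
  "card (cross (Suc n) t) = card (cross n t) + 2 * (\<Sum>k<t. card (cross n k))"
proof -
  have "card (cross (Suc n) t) = (\<Sum>x\<in>{- int t..int t}. card ((#) x ` cross n (t - nat \<bar>x\<bar>)))"
    unfolding cross_Suc by (rule card_UN_disjoint) (auto simp: finite_cross)
  also have "\<dots> = (\<Sum>x\<in>{- int t..int t}. card (cross n (t - nat \<bar>x\<bar>)))"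
    by (simp add: card_image)
  finally show ?thesis
    by (simp add: sum_symmetric_interval[of "\<lambda>k. card (cross n k)"])
qed

text \<open>Taking differences in \<open>t\<close> removes the sum from
  \<open>card_cross_Suc\<close>, so the closed forms below follow by induction on
  \<open>t\<close>.\<close>

lemma card_cross_Suc_Suc:
  "card (cross (Suc n) (Suc t)) = card (cross (Suc n) t) + card (cross n (Suc t)) + card (cross n t)"
  by (simp add: card_cross_Suc)

lemma card_cross_Suc_0: "card (cross (Suc n) 0) = card (cross n 0)"
  by (simp add: card_cross_Suc)

lemma card_cross_0: "card (cross 0 t) = (if even t then 1 else 0)"
  by (simp add: cross_0)

text \<open>Consecutive counts in dimension 0 add up to 1, so the dependence on parity disappears
  from dimension 1 on.\<close>

lemma card_cross_1: "card (cross 1 t) = t + 1"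
  by (induction t) (auto simp: card_cross_Suc_Suc card_cross_Suc_0 card_cross_0)

lemma card_cross_2: "real (card (cross 2 t)) = (real t + 1)^2"
proof (induction t)
  case 0
  then show ?case
    using card_cross_1[of 0] card_cross_Suc_0[of 1] unfolding Suc_1 by simp
next
  case (Suc t)
  have "card (cross 2 (Suc t)) = card (cross 2 t) + card (cross 1 (Suc t)) + card (cross 1 t)"
    using card_cross_Suc_Suc[of 1 t] unfolding Suc_1 .
  with Suc show ?case
    unfolding card_cross_1 by (simp add: algebra_simps power2_eq_square)
qed

lemma card_cross_3: "real (card (cross 3 t)) = (real t + 1) * (2 * (real t)^2 + 4 * real t + 3) / 3"
proof (induction t)
  case 0
  then show ?case
    using card_cross_2[of 0] card_cross_Suc_0[of 2] by simp
next
  case (Suc t)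
  have "card (cross 3 (Suc t)) = card (cross 3 t) + card (cross 2 (Suc t)) + card (cross 2 t)"
    using card_cross_Suc_Suc[of 2 t] by simp
  with Suc show ?case
    by (simp add: card_cross_2 field_simps power2_eq_square)
qed

lemma card_cross_4:
  "real (card (cross 4 t)) = ((real t)^2 + 2 * real t + 3) * (real t + 1)^2 / 3"
proof (induction t)
  case 0
  then show ?case
    using card_cross_3[of 0] card_cross_Suc_0[of 3] by simp
next
  case (Suc t)
  have "card (cross 4 (Suc t)) = card (cross 4 t) + card (cross 3 (Suc t)) + card (cross 3 t)"
    using card_cross_Suc_Suc[of 3 t] by simp
  with Suc show ?case
    by (simp add: card_cross_3 field_simps power2_eq_square)
qed

section \<open>Parametrising the squares of order four\<close>

text \<open>Rows and columns follow the Gray code \<open>00, 10, 11, 01\<close>, so that the cells become the vertices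
  of the 4-cube, with cells at distance \<open>(2, 2)\<close> antipodal. The affine function with slopes \<open>d\<close>
  and antipodal sum \<open>t\<close> is complemented with respect to \<open>t\<close> where \<open>i + j\<close> is odd. The \<open>div\<close> is
  exact for \<open>d\<close> in \<open>cross 4 t\<close>.\<close>

definition cube_value :: "nat \<Rightarrow> int list \<Rightarrow> nat \<Rightarrow> nat \<Rightarrow> int" where
  "cube_value t d i j =
     (let z = (int t - sum_list d) div 2 + [0, d ! 0, d ! 0 + d ! 1, d ! 1] ! i
                + [0, d ! 2, d ! 2 + d ! 3, d ! 3] ! j
      in if even (i + j) then z else int t - z)"

definition cube_square :: "nat \<Rightarrow> int list \<Rightarrow> nat mat" where
  "cube_square t d = mat 4 4 (\<lambda>(i, j). nat (cube_value t d i j))"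

text \<open>Here \<open>m\<close> is the value at the vertex 0000; the hypothesis says that it and
  the value at 1111 add up to \<open>t\<close>.\<close>

lemma cube_value_simps:
  assumes "2 * m + a + b + c + e = int t"
  shows
    "cube_value t [a, b, c, e] 0 0 = m" "cube_value t [a, b, c, e] 0 1 = int t - (m + c)"
    "cube_value t [a, b, c, e] 0 2 = m + c + e" "cube_value t [a, b, c, e] 0 3 = int t - (m + e)"
    "cube_value t [a, b, c, e] 1 0 = int t - (m + a)" "cube_value t [a, b, c, e] 1 1 = m + a + c"
    "cube_value t [a, b, c, e] 1 2 = int t - (m + a + c + e)" "cube_value t [a, b, c, e] 1 3 = m + a + e"
    "cube_value t [a, b, c, e] 2 0 = m + a + b" "cube_value t [a, b, c, e] 2 1 = int t - (m + a + b + c)"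
    "cube_value t [a, b, c, e] 2 2 = m + a + b + c + e" "cube_value t [a, b, c, e] 2 3 = int t - (m + a + b + e)"
    "cube_value t [a, b, c, e] 3 0 = int t - (m + b)" "cube_value t [a, b, c, e] 3 1 = m + b + c"
    "cube_value t [a, b, c, e] 3 2 = int t - (m + b + c + e)" "cube_value t [a, b, c, e] 3 3 = m + b + e"
proof -
  have "int t - sum_list [a, b, c, e] = 2 * m"
    using assms by simp
  then have "(int t - sum_list [a, b, c, e]) div 2 = m"
    by simp
  then show
    "cube_value t [a, b, c, e] 0 0 = m" "cube_value t [a, b, c, e] 0 1 = int t - (m + c)"
    "cube_value t [a, b, c, e] 0 2 = m + c + e" "cube_value t [a, b, c, e] 0 3 = int t - (m + e)"
    "cube_value t [a, b, c, e] 1 0 = int t - (m + a)" "cube_value t [a, b, c, e] 1 1 = m + a + c"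
    "cube_value t [a, b, c, e] 1 2 = int t - (m + a + c + e)" "cube_value t [a, b, c, e] 1 3 = m + a + e"
    "cube_value t [a, b, c, e] 2 0 = m + a + b" "cube_value t [a, b, c, e] 2 1 = int t - (m + a + b + c)"
    "cube_value t [a, b, c, e] 2 2 = m + a + b + c + e" "cube_value t [a, b, c, e] 2 3 = int t - (m + a + b + e)"
    "cube_value t [a, b, c, e] 3 0 = int t - (m + b)" "cube_value t [a, b, c, e] 3 1 = m + b + c"
    "cube_value t [a, b, c, e] 3 2 = int t - (m + b + c + e)" "cube_value t [a, b, c, e] 3 3 = m + b + e"
    unfolding cube_value_def by (simp_all add: numeral_3_eq_3)
qed

lemma cross_4E:
  assumes "d \<in> cross 4 t"
  obtains a b c e m where "d = [a, b, c, e]" "2 * m + a + b + c + e = int t"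
    "\<bar>a\<bar> + \<bar>b\<bar> + \<bar>c\<bar> + \<bar>e\<bar> \<le> int t"
proof -
  obtain a b c e k where *: "d = [a, b, c, e]"
      "nat \<bar>a\<bar> + nat \<bar>b\<bar> + nat \<bar>c\<bar> + nat \<bar>e\<bar> + 2 * k = t"
    using assms by (auto simp: cross_def length_Suc_conv numeral_eq_Suc)
  then have **: "\<bar>a\<bar> + \<bar>b\<bar> + \<bar>c\<bar> + \<bar>e\<bar> + 2 * int k = int t"
    by linarith
  then have "even (int t - (a + b + c + e))"
    unfolding **[symmetric] by auto
  then obtain m where "int t - (a + b + c + e) = 2 * m"
    by (elim evenE)
  with * ** show ?thesis
    using that[of a b c e m] by simp
qed

lemma cube_square_entry:
  assumes "d \<in> cross 4 t" "i < 4" "j < 4"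
  shows "int (cube_square t d $$ (i, j)) = cube_value t d i j"
proof -
  obtain a b c e m where d: "d = [a, b, c, e]" and *: "2 * m + a + b + c + e = int t"
      "\<bar>a\<bar> + \<bar>b\<bar> + \<bar>c\<bar> + \<bar>e\<bar> \<le> int t"
    using assms(1) by (rule cross_4E)
  \<comment> \<open>An affine value \<open>z\<close> satisfies \<open>2 * z - t\<close> =
    \<plusminus>a \<plusminus>b \<plusminus>c \<plusminus>e, so the norm bound gives 0 \<le> z \<le>
    t, and \<open>nat\<close> loses nothing.\<close>
  have "\<forall>i<4. \<forall>j<4. 0 \<le> cube_value t d i j"
    unfolding all_less_4 d cube_value_simps[OF *(1)] using * by (intro conjI; linarith)
  then show ?thesis
    using assms by (simp add: cube_square_def)
qed

text \<open>A row or column runs around a 2-face of the cube, where the alternating sum of an affine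
  function is 0; the two complemented cells contribute \<open>2 * t\<close>. A diagonal consists of
  two antipodal pairs, each of sum \<open>t\<close>.\<close>

lemma pandiagonal_cube_square:
  assumes "d \<in> cross 4 t"
  shows "pandiagonal_magic_square 4 (2 * t) (cube_square t d)"
proof -
  obtain a b c e m where d: "d = [a, b, c, e]" and *: "2 * m + a + b + c + e = int t"
    using assms by (rule cross_4E)
  have "\<forall>i<4. \<forall>j<4. int (cube_square t d $$ (i, j)) = cube_value t d i j"
    using cube_square_entry[OF assms] by blast
  note entries = this[unfolded all_less_4 d cube_value_simps[OF *], unfolded *[symmetric]]
  have "cube_square t d \<in> carrier_mat 4 4"
    by (simp add: cube_square_def)
  then show ?thesis
    unfolding pandiagonal_magic_square_def magic_square_def all_less_4 sum_lessThan_4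
      d of_nat_eq_iff[where ?'a = int, symmetric]
    by (simp add: entries[unfolded One_nat_def] *[symmetric] flip: numeral_2_eq_2)
qed

lemma cube_square_inj: "inj_on (cube_square t) (cross 4 t)"
proof (rule inj_onI)
  fix d d' assume d: "d \<in> cross 4 t" "d' \<in> cross 4 t" and eq: "cube_square t d = cube_square t d'"
  have entries: "cube_value t d i j = cube_value t d' i j" if "i < 4" "j < 4" for i j
    using cube_square_entry[OF d(1) that] cube_square_entry[OF d(2) that] eq by simp
  obtain a b c e m where 1: "d = [a, b, c, e]" "2 * m + a + b + c + e = int t"
    using d(1) by (rule cross_4E)
  obtain a' b' c' e' m' where 2: "d' = [a', b', c', e']" "2 * m' + a' + b' + c' + e' = int t"
    using d(2) by (rule cross_4E)
  note entries = entries[unfolded 1(1) 2(1)]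
  note simps = cube_value_simps[OF 1(2)] cube_value_simps[OF 2(2)]
  have "m = m'"
    using entries[of 0 0] unfolding simps by simp
  moreover have "a = a'"
    using entries[of 1 0] \<open>m = m'\<close> unfolding simps by simp
  moreover have "b = b'"
    using entries[of 3 0] \<open>m = m'\<close> unfolding simps by simp
  moreover have "c = c'"
    using entries[of 0 1] \<open>m = m'\<close> unfolding simps by simp
  moreover have "e = e'"
    using entries[of 0 3] \<open>m = m'\<close> unfolding simps by simp
  ultimately show "d = d'"
    using 1(1) 2(1) by simp
qed

text \<open>The lines on the right cover the cell and its antipode four times each; the three lines
  on the left account for all other coverings. With five lines against three, four times the pair is
  \<open>2 * s\<close>.\<close>

lemma antipodal_lines:
  fixes A :: "nat mat"
  assumes "i < 4" "j < 4"
  shows "4 * (A $$ (i, j) + A $$ ((i + 2) mod 4, (j + 2) mod 4))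
       + (\<Sum>b<4. A $$ ((i + 1) mod 4, b)) + (\<Sum>b<4. A $$ ((i + 3) mod 4, b))
       + (\<Sum>a<4. A $$ (a, (a + (j + 3 * i + 2) mod 4) mod 4))
     = (\<Sum>a<4. A $$ (a, (a + (j + 3 * i) mod 4) mod 4))
       + 2 * (\<Sum>a<4. A $$ (a, ((i + j) mod 4 + (4 - a)) mod 4))
       + (\<Sum>a<4. A $$ (a, j)) + (\<Sum>a<4. A $$ (a, (j + 2) mod 4))"
proof -
  have "i \<in> {0, 1, 2, 3}" "j \<in> {0, 1, 2, 3}"
    using assms by auto
  then show ?thesis
    unfolding sum_lessThan_4 by (elim insertE emptyE; hypsubst; simp flip: numeral_2_eq_2)
qed

lemma pandiagonal_4_antipodal:
  assumes "pandiagonal_magic_square 4 s A" "i < 4" "j < 4"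
  shows "2 * (A $$ (i, j) + A $$ ((i + 2) mod 4, (j + 2) mod 4)) = s"
  using antipodal_lines[OF assms(2,3), of A] assms
  by (simp add: pandiagonal_magic_square_def magic_square_def)

lemma cube_square_surj:
  assumes A: "pandiagonal_magic_square 4 (2 * t) A"
  obtains d where "d \<in> cross 4 t" "A = cube_square t d"
proof -
  \<comment> \<open>The neighbours of (0, 0) hold complemented values, so the slopes are read off at
    their antipodes, which hold \<open>m\<close> plus a slope.\<close>
  define m a b c e where "m = int (A $$ (0, 0))" and "a = int (A $$ (3, 2)) - m"
    and "b = int (A $$ (1, 2)) - m" and "c = int (A $$ (2, 3)) - m" and "e = int (A $$ (2, 1)) - m"
  note defs = this
  have antipodal: "int (A $$ (i, j)) + int (A $$ ((i + 2) mod 4, (j + 2) mod 4)) = int t"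
    if "i < 4" "j < 4" for i j
    using pandiagonal_4_antipodal[OF A that] by (simp flip: of_nat_add)
  have pairs:
    "int (A $$ (0, 0)) + int (A $$ (2, 2)) = int t" "int (A $$ (0, 1)) + int (A $$ (2, 3)) = int t"
    "int (A $$ (0, 2)) + int (A $$ (2, 0)) = int t" "int (A $$ (0, 3)) + int (A $$ (2, 1)) = int t"
    "int (A $$ (1, 0)) + int (A $$ (3, 2)) = int t" "int (A $$ (1, 1)) + int (A $$ (3, 3)) = int t"
    "int (A $$ (1, 2)) + int (A $$ (3, 0)) = int t" "int (A $$ (1, 3)) + int (A $$ (3, 1)) = int t"
    using antipodal[of 0 0] antipodal[of 0 1] antipodal[of 0 2] antipodal[of 0 3]
      antipodal[of 1 0] antipodal[of 1 1] antipodal[of 1 2] antipodal[of 1 3]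
    by (simp_all flip: numeral_2_eq_2)
  have "\<forall>i<4. int (\<Sum>j<4. A $$ (i, j)) = 2 * int t" "\<forall>j<4. int (\<Sum>i<4. A $$ (i, j)) = 2 * int t"
    using A by (simp_all add: pandiagonal_magic_square_def magic_square_def del: of_nat_sum)
  then have lines:
    "int (A $$ (0, 0)) + int (A $$ (0, 1)) + int (A $$ (0, 2)) + int (A $$ (0, 3)) = 2 * int t"
    "int (A $$ (1, 0)) + int (A $$ (1, 1)) + int (A $$ (1, 2)) + int (A $$ (1, 3)) = 2 * int t"
    "int (A $$ (0, 0)) + int (A $$ (1, 0)) + int (A $$ (2, 0)) + int (A $$ (3, 0)) = 2 * int t"
    "int (A $$ (0, 1)) + int (A $$ (1, 1)) + int (A $$ (2, 1)) + int (A $$ (3, 1)) = 2 * int t"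
    by (simp_all add: all_less_4 sum_lessThan_4)
  have cells:
    "int (A $$ (0, 0)) = m" "int (A $$ (0, 1)) = int t - (m + c)" "int (A $$ (0, 3)) = int t - (m + e)"
    "int (A $$ (1, 0)) = int t - (m + a)" "int (A $$ (1, 2)) = m + b" "int (A $$ (2, 1)) = m + e"
    "int (A $$ (2, 2)) = int t - m" "int (A $$ (2, 3)) = m + c" "int (A $$ (3, 0)) = int t - (m + b)"
    "int (A $$ (3, 2)) = m + a"
    using defs pairs(1,2,4,5,7) by simp_all
  have A02: "int (A $$ (0, 2)) = m + c + e"
    using lines(1) unfolding cells by simp
  then have A20: "int (A $$ (2, 0)) = int t - (m + c + e)"
    using pairs(3) by simp
  then have total: "2 * m + a + b + c + e = int t"
    using lines(3) unfolding cells by simp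
  \<comment> \<open>Row 1 gives the sum of the two cells; column 1 with the antipodal pair (1, 3),
    (3, 1) gives their difference.\<close>
  have "int (A $$ (1, 1)) + int (A $$ (1, 3)) = int t + a - b"
    and "int (A $$ (1, 1)) - int (A $$ (1, 3)) = c - e"
    using lines(2,4) pairs(8) unfolding cells by simp_all
  then have "int (A $$ (1, 1)) = m + a + c" "int (A $$ (1, 3)) = m + a + e"
    using total by simp_all
  moreover from this have "int (A $$ (3, 3)) = m + b + e" "int (A $$ (3, 1)) = m + b + c"
    using total pairs(6,8) by simp_all
  ultimately have entries:
    "int (A $$ (0, 0)) = m" "int (A $$ (0, 1)) = int t - (m + c)"
    "int (A $$ (0, 2)) = m + c + e" "int (A $$ (0, 3)) = int t - (m + e)"
    "int (A $$ (1, 0)) = int t - (m + a)" "int (A $$ (1, 1)) = m + a + c"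
    "int (A $$ (1, 2)) = int t - (m + a + c + e)" "int (A $$ (1, 3)) = m + a + e"
    "int (A $$ (2, 0)) = m + a + b" "int (A $$ (2, 1)) = int t - (m + a + b + c)"
    "int (A $$ (2, 2)) = m + a + b + c + e" "int (A $$ (2, 3)) = int t - (m + a + b + e)"
    "int (A $$ (3, 0)) = int t - (m + b)" "int (A $$ (3, 1)) = m + b + c"
    "int (A $$ (3, 2)) = int t - (m + b + c + e)" "int (A $$ (3, 3)) = m + b + e"
    using total cells A02 A20 by simp_all
  have values_eq: "\<forall>i<4. \<forall>j<4. int (A $$ (i, j)) = cube_value t [a, b, c, e] i j"
    unfolding all_less_4 cube_value_simps[OF total] entries by simp
  then have "\<forall>i<4. \<forall>j<4. 0 \<le> cube_value t [a, b, c, e] i j"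
    by (metis of_nat_0_le_iff)
  then have le: "\<bar>a\<bar> + \<bar>b\<bar> + \<bar>c\<bar> + \<bar>e\<bar> \<le> int t"
    using total unfolding all_less_4 cube_value_simps[OF total] by linarith
  \<comment> \<open>The witness \<open>k\<close> for \<open>cross\<close> is \<open>m\<close> plus
    all negative slopes, which is the minimum of the affine function.\<close>
  have "even (x - \<bar>x\<bar>)" for x :: int
    by (simp add: abs_if)
  then have "even (2 * m + (a - \<bar>a\<bar>) + (b - \<bar>b\<bar>) + (c - \<bar>c\<bar>) + (e - \<bar>e\<bar>))"
    by (intro dvd_add) simp_all
  then obtain k where "2 * m + (a - \<bar>a\<bar>) + (b - \<bar>b\<bar>) + (c - \<bar>c\<bar>) + (e - \<bar>e\<bar>) = 2 * k"
    by (elim evenE)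
  then have k: "\<bar>a\<bar> + \<bar>b\<bar> + \<bar>c\<bar> + \<bar>e\<bar> + 2 * k = int t"
    using total by simp
  then have "0 \<le> k"
    using le by simp
  with k have "int (nat \<bar>a\<bar> + (nat \<bar>b\<bar> + (nat \<bar>c\<bar> + nat \<bar>e\<bar>)) + 2 * nat k) = int t"
    by simp
  then have "nat \<bar>a\<bar> + (nat \<bar>b\<bar> + (nat \<bar>c\<bar> + nat \<bar>e\<bar>)) + 2 * nat k = t"
    by (simp only: of_nat_eq_iff)
  then have "[a, b, c, e] \<in> cross 4 t"
    unfolding cross_def by auto
  moreover have "A = cube_square t [a, b, c, e]"
  proof (rule eq_matI)
    have "A $$ (i, j) = nat (cube_value t [a, b, c, e] i j)" if "i < 4" "j < 4" for i j
      using that values_eq by (metis nat_int)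
    then show "A $$ (i, j) = cube_square t [a, b, c, e] $$ (i, j)"
      if "i < dim_row (cube_square t [a, b, c, e])" "j < dim_col (cube_square t [a, b, c, e])" for i j
      using that by (simp add: cube_square_def)
  qed (use A in \<open>auto simp: cube_square_def pandiagonal_magic_square_def magic_square_def\<close>)
  ultimately show ?thesis
    using that by blast
qed

section \<open>The count for order four\<close>

lemma MP_4_double: "MP 4 (2 * t) = card (cross 4 t)"
proof -
  have "cube_square t ` cross 4 t = {A. pandiagonal_magic_square 4 (2 * t) A}"
    by (auto intro: pandiagonal_cube_square elim!: cube_square_surj)
  then show ?thesis
    unfolding MP_def by (metis card_image cube_square_inj)
qed

lemma MP_4_odd:
  assumes "odd s"
  shows "MP 4 s = 0"
proof -
  have "\<not> pandiagonal_magic_square 4 s A" for A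
    using pandiagonal_4_antipodal[of s A 0 0] assms by auto
  then show ?thesis
    by (simp add: MP_def)
qed

lemma MP_4:
  "real (MP 4 s) = (if 2 dvd s then 1 / 48 * ((real s)^2 + 4 * real s + 12) * (real s + 2)^2 else 0)"
proof (cases "even s")
  case True
  then obtain t where "s = 2 * t"
    by (elim evenE)
  then have "real (MP 4 s) = ((real t)^2 + 2 * real t + 3) * (real t + 1)^2 / 3" "real s = 2 * real t"
    by (simp_all add: MP_4_double card_cross_4)
  then show ?thesis
    using True by (simp add: power2_eq_square field_simps)
next
  case False
  then show ?thesis
    by (simp add: MP_4_odd)
qed

theorem theorem0p4:
  fixes s :: nat
  shows "real (MP 4 s) =
           (if 2 dvd s then 1 / 48 * ((real s)^2 + 4 * real s + 12) * (real s + 2)^2 else 0)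
    \<and> real (MP 5 s) =
           1 / 8064 * (real s + 4) * (real s + 3) * (real s + 2) * (real s + 1) *
           ((real s)^2 + 5 * real s + 8) * ((real s)^2 + 5 * real s + 42)"
  using MP_4 MP_5 by (rule conjI)

end
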